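(* Consider a sporadic DAG task system with implicit deadlines scheduled by global rate-monotonic (RM) scheduling on $M$ identical processors. Let $\tau_k$ be a task with $k-1$ higher-priority tasks $\tau_1,\dots,\tau_{k-1}$, which are assumed to be schedulable. Then $\tau_k$ is schedulable by global RM on the $M$ processors if $$\left(\frac{\Psi_k}{T_k}+2\right)\prod_{j=1}^{k}\left(\frac{U_j}{M}+1\right)\le 3$$ or $$\sum_{j=1}^{k}\frac{U_j}{M}\le\ln\frac{3}{\frac{\Psi_k}{T_k}+2}.$$
   Context: A sporadic DAG task $\tau_i$ releases jobs with consecutive releases at least $T_i$ (its period) apart; with implicit deadlines, a job released at $r$ has absolute deadline $r+T_i$. Each job is a directed acyclic graph whose nodes (subtasks) are sequential pieces of execution and whose edges are precedence constraints: a node is ready when all its predecessors have been executed. Different jobs of the same task may have different DAGs, subject to: the total execution time of all nodes of a job of $\tau_i$ is at most $C_i>0$ (work), and the length of a longest (critical) path of a job's DAG, with nodes weighted by execution times, is at most $\Psi_i$, where $\Psi_i\le C_i$. $U_i=C_i/T_i$. Global RM: priorities are fixed, tasks with smaller periods have higher priority (so $T_i\le T_k$ for $i<k$, ties broken arbitrarily), scheduling is preemptive with migration, and at any time the (up to) $M$ highest-priority ready subtasks are executed on the $M$ processors. A task is schedulable if all its jobs always finish by their absolute deadlines. $k\ge2$. *)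

theory Defs
  imports "HOL-Analysis.Analysis"
begin

record dag =
  nodes :: "nat set"
  edges :: "(nat \<times> nat) set"
  exec_time :: "nat \<Rightarrow> real"

definition dag_wf :: "dag \<Rightarrow> bool" where
  "dag_wf G \<longleftrightarrow>
     finite (nodes G) \<and>
     edges G \<subseteq> nodes G \<times> nodes G \<and>
     acyclic (edges G) \<and>
     (\<forall>v\<in>nodes G. 0 \<le> exec_time G v)"

definition total_work :: "dag \<Rightarrow> real" where
  "total_work G = (\<Sum>v\<in>nodes G. exec_time G v)"

text \<open>The empty list is admitted as a path, so the maximum below is also meaningful for a DAG
  without nodes; for any other well-formed DAG it does not affect the maximum.\<close>

definition dag_paths :: "dag \<Rightarrow> nat list set" where
  "dag_paths G = {p. set p \<subseteq> nodes G \<and> successively (\<lambda>u v. (u, v) \<in> edges G) p}"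

definition critical_path_length :: "dag \<Rightarrow> real" where
  "critical_path_length G = Max ((\<lambda>p. sum_list (map (exec_time G) p)) ` dag_paths G)"

record dag_task =
  work_bound :: real     (* $C_i$ *)
  span_bound :: real     (* $\Psi_i$ *)
  period :: real         (* $T_i$, also the relative deadline *)

definition utilization :: "dag_task \<Rightarrow> real" where
  "utilization \<tau> = work_bound \<tau> / period \<tau>"

text \<open>A system of \<open>n\<close> tasks is a function of which only the values at \<open>1, \<dots>, n\<close> matter.
  The index of a task is its fixed priority, smaller indices meaning higher priority.\<close>

definition dag_task_system :: "nat \<Rightarrow> (nat \<Rightarrow> dag_task) \<Rightarrow> bool" where
  "dag_task_system n ts \<longleftrightarrow>
     (\<forall>i\<in>{1..n}. 0 < period (ts i) \<and> 0 < work_bound (ts i) \<and>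
        span_bound (ts i) \<le> work_bound (ts i))"

definition rate_monotonic :: "nat \<Rightarrow> (nat \<Rightarrow> dag_task) \<Rightarrow> bool" where
  "rate_monotonic n ts \<longleftrightarrow>
     (\<forall>i\<in>{1..n}. \<forall>j\<in>{1..n}. i < j \<longrightarrow> period (ts i) \<le> period (ts j))"

record job =
  release :: real
  job_dag :: dag

text \<open>\<open>jobs i j\<close> is the \<open>j\<close>-th job of task \<open>i\<close>, counted from 0. The system starts at time 0. A task
  that stops releasing jobs is modelled by jobs whose DAG has no nodes.\<close>

definition sporadic_jobs :: "nat \<Rightarrow> (nat \<Rightarrow> dag_task) \<Rightarrow> (nat \<Rightarrow> nat \<Rightarrow> job) \<Rightarrow> bool" where
  "sporadic_jobs n ts jobs \<longleftrightarrow>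
     (\<forall>i\<in>{1..n}. \<forall>j.
        0 \<le> release (jobs i j) \<and>
        release (jobs i j) + period (ts i) \<le> release (jobs i (Suc j)) \<and>
        dag_wf (job_dag (jobs i j)) \<and>
        total_work (job_dag (jobs i j)) \<le> work_bound (ts i) \<and>
        critical_path_length (job_dag (jobs i j)) \<le> span_bound (ts i))"

text \<open>A subtask is a triple (task, job number, node). A schedule gives the set of subtasks being
  executed at each instant. As this is a set, no subtask occupies two processors at once;
  processors are anonymous, so preemption and migration are unrestricted.\<close>

type_synonym subtask = "nat \<times> nat \<times> nat"

type_synonym schedule = "real \<Rightarrow> subtask set"

definition service :: "schedule \<Rightarrow> subtask \<Rightarrow> real \<Rightarrow> real" where
  "service \<sigma> x t = measure lborel {s \<in> {0..t}. x \<in> \<sigma> s}"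

definition executed ::
    "(nat \<Rightarrow> nat \<Rightarrow> job) \<Rightarrow> schedule \<Rightarrow> real \<Rightarrow> subtask \<Rightarrow> bool" where
  "executed jobs \<sigma> t = (\<lambda>(i, j, v).
     exec_time (job_dag (jobs i j)) v \<le> service \<sigma> (i, j, v) t)"

text \<open>Readiness refers to all direct and indirect predecessors. This differs from direct
  predecessors only if some execution times are 0: such a node satisfies \<^const>\<open>executed\<close>
  from the start and must not release its successors before its own predecessors are done.\<close>

definition ready_subtasks ::
    "nat \<Rightarrow> (nat \<Rightarrow> nat \<Rightarrow> job) \<Rightarrow> schedule \<Rightarrow> real \<Rightarrow> subtask set" where
  "ready_subtasks n jobs \<sigma> t =
     {(i, j, v). i \<in> {1..n} \<and> v \<in> nodes (job_dag (jobs i j)) \<and>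
        release (jobs i j) \<le> t \<and>
        (\<forall>u. (u, v) \<in> (edges (job_dag (jobs i j)))\<^sup>+ \<longrightarrow> executed jobs \<sigma> t (i, j, u)) \<and>
        \<not> executed jobs \<sigma> t (i, j, v)}"

text \<open>Preemptive global fixed-priority scheduling on \<open>M\<close> processors. Priorities are those of the
  tasks; the choice among ready subtasks of the same task is arbitrary.\<close>

definition global_fp_schedule ::
    "nat \<Rightarrow> nat \<Rightarrow> (nat \<Rightarrow> nat \<Rightarrow> job) \<Rightarrow> schedule \<Rightarrow> bool" where
  "global_fp_schedule M n jobs \<sigma> \<longleftrightarrow>
     (\<forall>x. {t. x \<in> \<sigma> t} \<in> sets borel) \<and>
     (\<forall>t\<ge>0. \<sigma> t \<subseteq> ready_subtasks n jobs \<sigma> t \<and>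
        finite (\<sigma> t) \<and> card (\<sigma> t) \<le> M \<and>
        (\<forall>x \<in> ready_subtasks n jobs \<sigma> t - \<sigma> t.
           card (\<sigma> t) = M \<and> (\<forall>y\<in>\<sigma> t. fst y \<le> fst x)))"

definition meets_deadline ::
    "(nat \<Rightarrow> dag_task) \<Rightarrow> (nat \<Rightarrow> nat \<Rightarrow> job) \<Rightarrow> schedule \<Rightarrow> nat \<Rightarrow> nat \<Rightarrow> bool" where
  "meets_deadline ts jobs \<sigma> i j \<longleftrightarrow>
     (\<forall>v\<in>nodes (job_dag (jobs i j)).
        executed jobs \<sigma> (release (jobs i j) + period (ts i)) (i, j, v))"

definition schedulable :: "nat \<Rightarrow> nat \<Rightarrow> (nat \<Rightarrow> dag_task) \<Rightarrow> nat \<Rightarrow> bool" where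
  "schedulable M n ts i \<longleftrightarrow>
     (\<forall>jobs \<sigma>. sporadic_jobs n ts jobs \<longrightarrow> global_fp_schedule M n jobs \<sigma> \<longrightarrow>
        (\<forall>j. meets_deadline ts jobs \<sigma> i j))"

end

theory Submission
  imports Defs
begin

text \<open>Suppose a job of \<open>\<tau>\<^sub>k\<close> released at \<open>r\<close> is unfinished at \<open>r + t\<close>, where \<open>t \<le> T\<^sub>k\<close>, and split the
  interval between these instants. While all \<open>M\<close> processors serve tasks \<open>1, \<dots>, k\<close>, they consume
  less than \<open>C\<^sub>k\<close> plus the work of the higher-priority jobs that overlap the interval. In the rest
  of the interval every ready node of the job is running, so its total length is at most \<open>\<Psi>\<^sub>k\<close>.
  A schedulable task \<open>\<tau>\<^sub>i\<close> has at most \<open>q + 1\<close> overlapping jobs if \<open>t \<le> q T\<^sub>i\<close>. It therefore suffices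
  to look at \<open>t = T\<^sub>k\<close> and at the points \<open>t\<^sub>i = \<lfloor>T\<^sub>k / T\<^sub>i\<rfloor> T\<^sub>i\<close>: there the demand of \<open>\<tau>\<^sub>i\<close> is at most
  \<open>2 t\<^sub>i U\<^sub>i\<close>, or \<open>3 t\<^sub>i U\<^sub>i\<close> past \<open>t\<^sub>i\<close>. If all these points fail, ordering the tasks by \<open>t\<^sub>i\<close> makes the
  bounds telescope into a product, which contradicts the hypothesis. The logarithmic condition
  implies the product condition because \<open>1 + x \<le> exp x\<close>.\<close>

section \<open>Paths of a DAG\<close>

text \<open>Along a path every earlier node precedes every later one in the transitive closure, so a
  repetition would close a cycle.\<close>

lemma dag_path_distinct:
  assumes "dag_wf G" "p \<in> dag_paths G"
  shows "distinct p"
proof -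
  have "successively (\<lambda>u v. (u, v) \<in> (edges G)\<^sup>+) p"
    using assms(2) unfolding dag_paths_def by (auto elim!: successively_mono)
  moreover have "transp (\<lambda>u v. (u, v) \<in> (edges G)\<^sup>+)"
    by (auto intro!: transpI intro: trancl_trans)
  ultimately have "sorted_wrt (\<lambda>u v. (u, v) \<in> (edges G)\<^sup>+) p"
    by (simp add: successively_conv_sorted_wrt)
  moreover have "(u, u) \<notin> (edges G)\<^sup>+" for u
    using assms(1) by (auto simp: dag_wf_def acyclic_def)
  ultimately show ?thesis
    by (induction p) auto
qed

text \<open>\<open>Max\<close> is informative only on a finite set; distinctness leaves finitely
  many paths.\<close>

lemma dag_path_le_critical_path_length:
  assumes "dag_wf G" "p \<in> dag_paths G"
  shows "sum_list (map (exec_time G) p) \<le> critical_path_length G"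
proof -
  have "dag_paths G \<subseteq> {p. set p \<subseteq> nodes G \<and> distinct p}"
    using dag_path_distinct[OF assms(1)] by (auto simp: dag_paths_def)
  moreover have "finite {p. set p \<subseteq> nodes G \<and> distinct p}"
    using assms(1) by (intro finite_subset_distinct) (simp add: dag_wf_def)
  ultimately have "finite (dag_paths G)"
    using finite_subset by blast
  then show ?thesis
    using assms(2) by (simp add: critical_path_length_def)
qed

text \<open>The empty path has weight 0. This is how the span bound of a task is seen to be
  non-negative.\<close>

lemma critical_path_length_nonneg:
  assumes "dag_wf G"
  shows "0 \<le> critical_path_length G"
  using dag_path_le_critical_path_length[OF assms, of "[]"] by (simp add: dag_paths_def)

text \<open>Readiness refers to indirect predecessors, so a chain of waiting nodes may skip over
  nodes of the DAG. Filling them in only adds weight, as execution times are non-negative.\<close>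

lemma dag_path_extend:
  assumes "dag_wf G" "p \<in> dag_paths G" "p \<noteq> []" "(last p, v) \<in> (edges G)\<^sup>+"
  shows "\<exists>q\<in>dag_paths G. q \<noteq> [] \<and> last q = v \<and>
    sum_list (map (exec_time G) p) + exec_time G v \<le> sum_list (map (exec_time G) q)"
  using assms(4)
proof (induction rule: trancl_induct)
  case (base y)
  then have "p @ [y] \<in> dag_paths G"
    using assms by (auto simp: dag_paths_def dag_wf_def successively_append_iff)
  then show ?case
    by (intro bexI[of _ "p @ [y]"]) auto
next
  case (step y z)
  then obtain q where q: "q \<in> dag_paths G" "q \<noteq> []" "last q = y"
    "sum_list (map (exec_time G) p) + exec_time G y \<le> sum_list (map (exec_time G) q)"
    by blast
  have "q @ [z] \<in> dag_paths G" and "0 \<le> exec_time G y"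
    using assms(1) q step.hyps by (auto simp: dag_paths_def dag_wf_def successively_append_iff)
  then show ?case
    using q by (intro bexI[of _ "q @ [z]"]) auto
qed

section \<open>Numerical part of the test\<close>

text \<open>Elements are inserted in increasing order of \<open>t\<close>, so the new one is maximal
  and leaves the earlier bounds unchanged. With S and P the sum and product so far, its value is at
  most D + S, hence at most D * P, and the bounds telescope.\<close>

lemma sum_le_prod_ranked:
  fixes t u :: "'a \<Rightarrow> real"
  assumes "finite I" "\<And>i. i \<in> I \<Longrightarrow> 0 \<le> t i" "\<And>i. i \<in> I \<Longrightarrow> 0 \<le> u i"
    "\<And>i. i \<in> I \<Longrightarrow> t i \<le> D + (\<Sum>l\<in>{l\<in>I. t l < t i}. u l * t l)"
  shows "(\<Sum>i\<in>I. u i * t i) \<le> D * ((\<Prod>i\<in>I. u i + 1) - 1)"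
  using assms
proof (induction I rule: finite_ranking_induct[where f = t])
  case empty
  then show ?case by simp
next
  case (insert m I)
  show ?case
  proof (cases "m \<in> I")
    case True
    then show ?thesis using insert by (simp add: insert_absorb)
  next
    case False
    have "{l \<in> insert m I. t l < t i} = {l \<in> I. t l < t i}" if "i \<in> insert m I" for i
      using insert.hyps(2) that by force
    then have le: "t i \<le> D + (\<Sum>l\<in>{l\<in>I. t l < t i}. u l * t l)" if "i \<in> insert m I" for i
      using insert.prems(3)[OF that] that by simp
    let ?S = "\<Sum>i\<in>I. u i * t i" and ?P = "\<Prod>i\<in>I. u i + 1"
    have IH: "?S \<le> D * (?P - 1)"
      using insert.prems le by (intro insert.IH) auto
    have "t m \<le> D + (\<Sum>l\<in>{l\<in>I. t l < t m}. u l * t l)"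
      using le by simp
    also have "\<dots> \<le> D + ?S"
      using insert.hyps insert.prems by (intro add_left_mono sum_mono2) auto
    also have "\<dots> \<le> D * ?P"
      using IH by (simp add: algebra_simps)
    finally have "u m * t m \<le> u m * (D * ?P)"
      using insert.prems by (intro mult_left_mono) auto
    then show ?thesis
      using IH False insert.hyps by (simp add: algebra_simps)
  qed
qed

text \<open>If every candidate point fails, the previous lemma bounds the sum by a multiple of
  \<open>D\<close>, which itself contains that sum twice. Eliminating \<open>D\<close> contradicts
  \<open>cond\<close>.\<close>

lemma k_point_test:
  fixes t u :: "'a \<Rightarrow> real"
  assumes "finite I" "\<And>i. i \<in> I \<Longrightarrow> 0 \<le> t i" "\<And>i. i \<in> I \<Longrightarrow> 0 \<le> u i" "0 < A" "0 < T"
    and cond: "(A / T + 2) * (\<Prod>i\<in>I. u i + 1) \<le> 3"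
  shows "\<exists>\<tau>\<in>insert T (t ` I). A + (\<Sum>l\<in>I. u l * t l * (2 + of_bool (t l < \<tau>))) \<le> \<tau>"
proof (rule ccontr)
  assume "\<not> ?thesis"
  then have less: "\<tau> < A + (\<Sum>l\<in>I. u l * t l * (2 + of_bool (t l < \<tau>)))"
    if "\<tau> \<in> insert T (t ` I)" for \<tau>
    using that by (meson linorder_not_le)
  let ?S = "\<Sum>i\<in>I. u i * t i" and ?P = "\<Prod>i\<in>I. u i + 1"
  \<comment> \<open>The part of the demand that does not depend on the candidate point; only the
    third copy of each term does.\<close>
  define D where "D = A + 2 * ?S"
  have split: "A + (\<Sum>l\<in>I. u l * t l * (2 + of_bool (t l < \<tau>)))
      = D + (\<Sum>l\<in>{l\<in>I. t l < \<tau>}. u l * t l)" for \<tau>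
    using assms(1)
  proof -
    have "(\<Sum>l\<in>I. u l * t l * (2 + of_bool (t l < \<tau>)))
        = (\<Sum>l\<in>I. 2 * (u l * t l) + (if t l < \<tau> then u l * t l else 0))"
      by (intro sum.cong) auto
    then show ?thesis
      using assms(1) by (simp add: D_def sum.distrib sum_distrib_left sum.inter_filter)
  qed
  have "t i \<le> D + (\<Sum>l\<in>{l\<in>I. t l < t i}. u l * t l)" if "i \<in> I" for i
    using less[of "t i"] that split by simp
  then have S: "?S \<le> D * (?P - 1)"
    using assms by (intro sum_le_prod_ranked) auto
  have "T < D + (\<Sum>l\<in>{l\<in>I. t l < T}. u l * t l)"
    using less[of T] split by simp
  also have "\<dots> \<le> D + ?S"
    using assms by (intro add_left_mono sum_mono2) auto
  also have "\<dots> \<le> D * ?P"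
    using S by (simp add: algebra_simps)
  finally have T: "T < D * ?P" .
  have P1: "1 \<le> ?P"
    using assms by (intro prod_ge_1) auto
  have c: "(A + 2 * T) * ?P \<le> 3 * T"
    using cond \<open>0 < T\<close> by (simp add: field_simps)
  \<comment> \<open>Strict positivity of \<open>A\<close> forces \<open>2 * ?P < 3\<close>, so that
    the strict bound on \<open>T\<close> may be multiplied by \<open>3 - 2 * ?P\<close>.\<close>
  have "0 < A * ?P"
    using \<open>0 < A\<close> P1 by (intro mult_pos_pos) auto
  then have "T * (2 * ?P) < T * 3"
    using c by (simp add: algebra_simps)
  then have pos: "0 < 3 - 2 * ?P"
    using \<open>0 < T\<close> by (simp add: mult_less_cancel_left_pos)
  \<comment> \<open>Insert the bound \<open>S\<close> into \<open>A = D - 2 * ?S\<close>.\<close>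
  have "D * (3 - 2 * ?P) \<le> A"
    using S by (simp add: D_def algebra_simps)
  then have "D * (3 - 2 * ?P) * ?P \<le> A * ?P"
    using P1 by (intro mult_right_mono) auto
  moreover have "T * (3 - 2 * ?P) < D * ?P * (3 - 2 * ?P)"
    using T pos by (rule mult_strict_right_mono)
  ultimately show False
    using c by (simp add: algebra_simps)
qed

lemma prod_le_of_sum_le_ln:
  fixes u :: "'a \<Rightarrow> real"
  assumes "\<And>i. i \<in> I \<Longrightarrow> 0 \<le> u i" "0 < c" "(\<Sum>i\<in>I. u i) \<le> ln c"
  shows "(\<Prod>i\<in>I. u i + 1) \<le> c"
proof (cases "finite I")
  case True
  have "(\<Prod>i\<in>I. u i + 1) \<le> (\<Prod>i\<in>I. exp (u i))"
    using assms(1) by (intro prod_mono) (auto simp: add.commute)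
  also have "\<dots> = exp (\<Sum>i\<in>I. u i)"
    using True by (simp add: exp_sum)
  also have "\<dots> \<le> c"
    using assms(2,3) by (simp add: ln_ge_iff)
  finally show ?thesis .
next
  case False
  \<comment> \<open>Over an infinite set the sum is 0 and the product 1 by convention, and
    \<open>0 \<le> ln c\<close> means \<open>1 \<le> c\<close>.\<close>
  then show ?thesis using assms(2,3) by (simp add: ln_ge_iff)
qed

section \<open>Executions of a global fixed-priority schedule\<close>

lemma Icc_fmeasurable [simp]: "{a..b::real} \<in> fmeasurable lborel"
  by (auto simp: fmeasurable_def emeasure_lborel_Icc_eq)

text \<open>Double counting: integrate over \<open>B\<close> the number of sets \<open>R x\<close>
  containing a point. With \<open>B\<close> the fully busy instants, this distributes the processor
  time among the subtasks.\<close>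

lemma measure_count_sum:
  assumes "finite F" "B \<in> fmeasurable N" "\<And>x. x \<in> F \<Longrightarrow> R x \<in> sets N"
    "\<And>s. s \<in> B \<Longrightarrow> card {x \<in> F. s \<in> R x} = m"
  shows "real m * measure N B = (\<Sum>x\<in>F. measure N (B \<inter> R x))"
proof -
  have fin: "B \<inter> R x \<in> fmeasurable N" if "x \<in> F" for x
    using assms that by (intro fmeasurable_Int_fmeasurable) auto
  have "real m * measure N B = (\<integral>s. real m * indicator B s \<partial>N)"
    using assms(2) by (simp add: fmeasurableD)
  also have "\<dots> = (\<integral>s. (\<Sum>x\<in>F. indicator (B \<inter> R x) s) \<partial>N)"
  proof (intro arg_cong[where f = "lebesgue_integral N"] ext)
    fix s
    have "(\<Sum>x\<in>F. indicator (R x) s :: real) = card {x \<in> F. s \<in> R x}"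
      using assms(1) by (simp add: indicator_def Int_def)
    then show "real m * indicator B s = (\<Sum>x\<in>F. indicator (B \<inter> R x) s)"
      using assms(4)[of s] by (cases "s \<in> B") (auto simp: indicator_inter_arith)
  qed
  also have "\<dots> = (\<Sum>x\<in>F. measure N (B \<inter> R x))"
    using fin by (subst Bochner_Integration.integral_sum)
      (auto simp: fmeasurable_def intro!: sum.cong)
  finally show ?thesis .
qed

locale fp_execution =
  fixes M n :: nat and ts :: "nat \<Rightarrow> dag_task" and jobs :: "nat \<Rightarrow> nat \<Rightarrow> job"
    and \<sigma> :: schedule
  assumes system: "dag_task_system n ts"
    and sporadic: "sporadic_jobs n ts jobs"
    and fp: "global_fp_schedule M n jobs \<sigma>"
begin

abbreviation "G i j \<equiv> job_dag (jobs i j)"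
abbreviation "rel i j \<equiv> release (jobs i j)"
abbreviation "runs x \<equiv> {t. x \<in> \<sigma> t}"

lemma period_pos: "i \<in> {1..n} \<Longrightarrow> 0 < period (ts i)"
  using system by (simp add: dag_task_system_def)

lemma work_bound_pos: "i \<in> {1..n} \<Longrightarrow> 0 < work_bound (ts i)"
  using system by (simp add: dag_task_system_def)

lemma job_facts:
  assumes "i \<in> {1..n}"
  shows "0 \<le> rel i j" "rel i j + period (ts i) \<le> rel i (Suc j)" "dag_wf (G i j)"
    "total_work (G i j) \<le> work_bound (ts i)" "critical_path_length (G i j) \<le> span_bound (ts i)"
  using sporadic assms by (auto simp: sporadic_jobs_def)

lemma runs_measurable [measurable]: "runs x \<in> sets borel"
  using fp unfolding global_fp_schedule_def by blast

lemma running_ready: "0 \<le> t \<Longrightarrow> \<sigma> t \<subseteq> ready_subtasks n jobs \<sigma> t"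
  using fp by (simp add: global_fp_schedule_def)

section \<open>Service as a function of time\<close>

lemma service_alt: "service \<sigma> x t = measure lborel ({0..t} \<inter> runs x)"
  by (simp add: service_def Int_def)

lemma interval_runs_fmeasurable: "{a..b} \<inter> runs x \<in> fmeasurable lborel"
  by (intro fmeasurable_Int_fmeasurable) auto

lemma measure_le_service:
  assumes "A \<in> sets borel" "A \<subseteq> {0..t} \<inter> runs x"
  shows "measure lborel A \<le> service \<sigma> x t"
  unfolding service_alt using assms interval_runs_fmeasurable
  by (intro measure_mono_fmeasurable) auto

lemma service_mono: "s \<le> t \<Longrightarrow> service \<sigma> x s \<le> service \<sigma> x t"
  unfolding service_alt[of x s] by (intro measure_le_service) auto

lemma service_increment:
  assumes "0 \<le> s" "s \<le> t"
  shows "service \<sigma> x t \<le> service \<sigma> x s + measure lborel ({s..t} \<inter> runs x)"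
proof -
  have "{0..t} \<inter> runs x = ({0..s} \<inter> runs x) \<union> ({s..t} \<inter> runs x)"
    using assms by auto
  then show ?thesis
    unfolding service_alt using interval_runs_fmeasurable
    by (simp add: fmeasurableD measure_Un_le)
qed

text \<open>A subtask gains no more service than the time that elapses, so service is
  1-Lipschitz.\<close>

lemma service_continuous: "continuous_on {0..} (service \<sigma> x)"
proof (rule lipschitz_on_continuous_on)
  have *: "dist (service \<sigma> x t) (service \<sigma> x s) \<le> dist t s" if "0 \<le> s" "s \<le> t" for s t
  proof -
    have "measure lborel ({s..t} \<inter> runs x) \<le> measure lborel {s..t}"
      by (intro measure_mono_fmeasurable) auto
    then show ?thesis
      using service_increment[OF that, of x] service_mono[OF that(2), of x] that
      by (simp add: dist_real_def)
  qed
  show "1-lipschitz_on {0..} (service \<sigma> x)"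
  proof (rule lipschitz_onI)
    fix s t :: real assume "s \<in> {0..}" "t \<in> {0..}"
    then show "dist (service \<sigma> x s) (service \<sigma> x t) \<le> 1 * dist s t"
      using *[of s t] *[of t s] by (cases "s \<le> t") (auto simp: dist_commute)
  qed simp
qed

lemma executed_mono: "executed jobs \<sigma> s x \<Longrightarrow> s \<le> t \<Longrightarrow> executed jobs \<sigma> t x"
  using service_mono[of s t x] by (cases x) (auto simp: executed_def)

lemma executed_not_running: "executed jobs \<sigma> s x \<Longrightarrow> s \<le> t \<Longrightarrow> 0 \<le> t \<Longrightarrow> x \<notin> \<sigma> t"
  using running_ready[of t] executed_mono[of s x t] by (auto simp: ready_subtasks_def)

text \<open>To exceed the execution time, service would first have to equal it, by continuity. From
  then on the subtask is executed, hence never runs and gains nothing.\<close>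

lemma service_le_exec_time:
  assumes "0 \<le> exec_time (G i j) v"
  shows "service \<sigma> (i, j, v) t \<le> exec_time (G i j) v"
proof (rule ccontr)
  let ?x = "(i, j, v)"
  assume *: "\<not> ?thesis"
  have t: "0 \<le> t"
  proof (rule ccontr)
    assume "\<not> 0 \<le> t"
    then show False using * assms by (simp add: service_alt)
  qed
  have "service \<sigma> ?x 0 \<le> measure lborel {0..0::real}"
    unfolding service_alt by (intro measure_mono_fmeasurable Icc_fmeasurable) auto
  then obtain s where s: "0 \<le> s" "s \<le> t" "service \<sigma> ?x s = exec_time (G i j) v"
    using IVT'[of "service \<sigma> ?x" 0 "exec_time (G i j) v" t] * t assms
      continuous_on_subset[OF service_continuous, of "{0..t}"] by fastforce
  then have "executed jobs \<sigma> s ?x"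
    by (simp add: executed_def)
  then have "{s..t} \<inter> runs ?x = {}"
    using s executed_not_running by force
  then show False
    using service_increment[OF s(1,2), of ?x] s(3) * by simp
qed

lemma exec_time_nonneg: "i \<in> {1..n} \<Longrightarrow> v \<in> nodes (G i j) \<Longrightarrow> 0 \<le> exec_time (G i j) v"
  using job_facts(3) by (auto simp: dag_wf_def)

section \<open>Covering time by the run times along a path\<close>

lemma node_run_time_le:
  assumes "i \<in> {1..n}" "v \<in> nodes (G i j)" "A \<in> sets borel" "A \<subseteq> {0..t} \<inter> runs (i, j, v)"
  shows "measure lborel A \<le> exec_time (G i j) v"
  using measure_le_service[OF assms(3,4)] service_le_exec_time[OF exec_time_nonneg[OF assms(1,2)]]
  by (rule order_trans)

text \<open>Going backwards from an unfinished node, the set \<open>N\<close> is covered by run times of a chain of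
  nodes: the last predecessor to finish makes a node ready, and from then on the node runs
  throughout \<open>N\<close>.\<close>

lemma path_covers:
  assumes i: "i \<in> {1..n}" and r: "rel i j \<le> r"
    and N: "N \<in> sets borel" "N \<subseteq> {r..}"
      "\<And>s v. s \<in> N \<Longrightarrow> (i, j, v) \<in> ready_subtasks n jobs \<sigma> s \<Longrightarrow> (i, j, v) \<in> \<sigma> s"
    and "v \<in> nodes (G i j)"
    and "\<And>s. r \<le> s \<Longrightarrow> s < f \<Longrightarrow> \<not> executed jobs \<sigma> s (i, j, v)"
  shows "\<exists>p\<in>dag_paths (G i j). p \<noteq> [] \<and> last p = v \<and>
    measure lborel (N \<inter> {..<f}) \<le> sum_list (map (exec_time (G i j)) p)"
proof -
  \<comment> \<open>The induction follows the precedence order downwards; \<open>f\<close> is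
    generalized because each predecessor is traced back from its own finishing time.\<close>
  have "wf ((edges (G i j))\<^sup>+)"
    using job_facts(3)[OF i, of j] finite_subset[of "edges (G i j)" "nodes (G i j) \<times> nodes (G i j)"]
    by (auto simp: dag_wf_def intro!: wf_trancl finite_acyclic_wf)
  then show ?thesis
    using assms(6,7)
  proof (induction v arbitrary: f rule: wf_induct_rule)
    case (less v)
    let ?E = "(edges (G i j))\<^sup>+" and ?ex = "\<lambda>s u. executed jobs \<sigma> s (i, j, u)"
    have wf: "dag_wf (G i j)" using job_facts(3)[OF i] .
    have r0: "0 \<le> r" using job_facts(1)[OF i, of j] r by linarith
    \<comment> \<open>The predecessors still unfinished at \<open>r\<close>: only these can delay
      \<open>v\<close> inside the window.\<close>
    define Q where "Q = {u. (u, v) \<in> ?E \<and> \<not> ?ex r u}"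
    have pred_node: "u \<in> nodes (G i j)" if "(u, v) \<in> ?E" for u
      using that wf trancl_subset_Sigma[of "edges (G i j)" "nodes (G i j)"] by (auto simp: dag_wf_def)
    have runs: "N \<inter> {\<rho><..<f} \<subseteq> {0..f} \<inter> runs (i, j, v)"
      if "\<And>u s. (u, v) \<in> ?E \<Longrightarrow> \<rho> < s \<Longrightarrow> r \<le> s \<Longrightarrow> s < f \<Longrightarrow> ?ex s u" for \<rho>
    proof
      fix s assume s: "s \<in> N \<inter> {\<rho><..<f}"
      then have "r \<le> s" using N(2) by auto
      then have "(i, j, v) \<in> ready_subtasks n jobs \<sigma> s"
        using s that less.prems r i by (auto simp: ready_subtasks_def)
      then show "s \<in> {0..f} \<inter> runs (i, j, v)"
        using s N(3) \<open>r \<le> s\<close> r0 by auto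
    qed
    show ?case
    proof (cases "Q = {} \<or> f < r")
      case True
      \<comment> \<open>Any point below \<open>r\<close> would do in place of \<open>r - 1\<close>:
        \<open>N\<close> starts at \<open>r\<close>, so the open left end cuts off nothing.\<close>
      have "N \<inter> {r - 1<..<f} \<subseteq> {0..f} \<inter> runs (i, j, v)"
        using True by (intro runs) (auto simp: Q_def intro: executed_mono)
      moreover have "N \<inter> {r - 1<..<f} = N \<inter> {..<f}"
        using N(2) by force
      ultimately have "measure lborel (N \<inter> {..<f}) \<le> exec_time (G i j) v"
        using N(1) by (intro node_run_time_le[OF i less.prems(1)]) auto
      then show ?thesis
        using less.prems(1) by (intro bexI[of _ "[v]"]) (auto simp: dag_paths_def)
    next
      case False
      \<comment> \<open>The supremum of \<open>S u\<close> is the finishing time of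
        \<open>u\<close>, capped at \<open>f\<close>; \<rho> below is the latest of these.\<close>
      define S where "S = (\<lambda>u. {s \<in> {r..f}. \<not> ?ex s u})"
      have Q: "finite Q" "Q \<noteq> {}"
        using False wf pred_node by (auto simp: Q_def dag_wf_def intro: finite_subset)
      have S: "r \<in> S u" "bdd_above (S u)" if "u \<in> Q" for u
        using that False by (auto simp: S_def Q_def)
      define \<rho> where "\<rho> = Max ((\<lambda>u. Sup (S u)) ` Q)"
      have "\<rho> \<in> (\<lambda>u. Sup (S u)) ` Q"
        unfolding \<rho>_def using Q by (intro Max_in) auto
      then obtain u where u: "u \<in> Q" "\<rho> = Sup (S u)" by auto
      have before: "\<not> ?ex s u" if "r \<le> s" "s < \<rho>" for s
      proof -
        obtain s' where "s' \<in> S u" "s < s'"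
          using \<open>s < \<rho>\<close> u S[OF u(1)] less_cSup_iff[of "S u" s] by auto
        then show ?thesis
          using executed_mono[of s "(i, j, u)" s'] by (auto simp: S_def)
      qed
      have after: "?ex s w" if "(w, v) \<in> ?E" "\<rho> < s" "r \<le> s" "s < f" for w s
      proof (cases "w \<in> Q")
        case True
        then have "Sup (S w) \<le> \<rho>"
          unfolding \<rho>_def using Q by (intro Max_ge) auto
        then have "s \<notin> S w"
          using cSup_upper[OF _ S(2)[OF True], of s] that by auto
        then show ?thesis
          using that by (auto simp: S_def)
      next
        case False
        then show ?thesis
          using that by (auto simp: Q_def intro: executed_mono)
      qed
      have uv: "(u, v) \<in> ?E" using u by (simp add: Q_def)
      obtain p where p: "p \<in> dag_paths (G i j)" "p \<noteq> []" "last p = u"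
        "measure lborel (N \<inter> {..<\<rho>}) \<le> sum_list (map (exec_time (G i j)) p)"
        using less.IH[OF uv pred_node[OF uv] before] by blast
      obtain q where q: "q \<in> dag_paths (G i j)" "q \<noteq> []" "last q = v"
        "sum_list (map (exec_time (G i j)) p) + exec_time (G i j) v
          \<le> sum_list (map (exec_time (G i j)) q)"
        using dag_path_extend[OF wf p(1,2)] p(3) uv by blast
      have v: "measure lborel (N \<inter> {\<rho><..<f}) \<le> exec_time (G i j) v"
        using N(1) runs[OF after] by (intro node_run_time_le[OF i less.prems(1)]) auto
      have fm: "N \<inter> {..<a} \<in> fmeasurable lborel" for a
      proof -
        have "N \<inter> {..<a} = {r..a} \<inter> (N \<inter> {..<a})"
          using N(2) by auto
        moreover have "{r..a} \<inter> (N \<inter> {..<a}) \<in> fmeasurable lborel"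
          using N(1) by (intro fmeasurable_Int_fmeasurable) auto
        ultimately show ?thesis by simp
      qed
      have fm2: "N \<inter> {\<rho><..<f} \<in> fmeasurable lborel"
        by (rule fmeasurableI2[OF fm[of f]]) (use N(1) in auto)
      \<comment> \<open>The two pieces omit only the point \<rho>, a null set.\<close>
      have "measure lborel (N \<inter> {..<f})
          \<le> measure lborel ((N \<inter> {..<\<rho>} \<union> {\<rho>}) \<union> (N \<inter> {\<rho><..<f}))"
        using N(1) fm fm2 Icc_fmeasurable[of \<rho> \<rho>]
        by (intro measure_mono_fmeasurable fmeasurable.Un) auto
      also have "\<dots> \<le> measure lborel (N \<inter> {..<\<rho>} \<union> {\<rho>}) + measure lborel (N \<inter> {\<rho><..<f})"
        using N(1) by (intro measure_Un_le) auto
      also have "measure lborel (N \<inter> {..<\<rho>} \<union> {\<rho>})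
          \<le> measure lborel (N \<inter> {..<\<rho>}) + measure lborel {\<rho>}"
        using N(1) by (intro measure_Un_le) auto
      finally have "measure lborel (N \<inter> {..<f})
          \<le> measure lborel (N \<inter> {..<\<rho>}) + measure lborel (N \<inter> {\<rho><..<f})"
        by simp
      then show ?thesis
        using q p(4) v by (intro bexI[of _ q]) auto
    qed
qed
qed

section \<open>Counting job releases\<close>

lemma release_spacing:
  assumes "i \<in> {1..n}"
  shows "rel i j + real m * period (ts i) \<le> rel i (j + m)"
proof (induction m)
  case (Suc m)
  then show ?case
    using job_facts(2)[OF assms, of "j + m"] by (simp add: algebra_simps)
qed simp

lemma finite_released: "i \<in> {1..n} \<Longrightarrow> finite {j. rel i j < b}"
proof -
  assume i: "i \<in> {1..n}"
  obtain m :: nat where m: "b / period (ts i) < real m"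
    using reals_Archimedean2 by blast
  have "j < m" if "rel i j < b" for j
  proof (rule ccontr)
    assume "\<not> j < m"
    then have "real m * period (ts i) \<le> real j * period (ts i)"
      using period_pos[OF i] by (intro mult_right_mono) auto
    also have "\<dots> \<le> rel i j"
      using release_spacing[OF i, of 0 j] job_facts(1)[OF i, of 0] by simp
    finally show False
      using m that period_pos[OF i] by (simp add: field_simps)
  qed
  then show ?thesis
    using finite_subset[of "{j. rel i j < b}" "{..<m}"] by auto
qed

text \<open>The first and last releases strictly inside the window are less than
  \<open>Suc q\<close> periods apart, so their indices differ by at most \<open>q\<close>.\<close>

lemma card_released_le:
  assumes i: "i \<in> {1..n}" and b: "b \<le> a + real (Suc q) * period (ts i)"
  shows "card {j. a < rel i j \<and> rel i j < b} \<le> Suc q"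
proof (cases "{j. a < rel i j \<and> rel i j < b} = {}")
  case False
  let ?S = "{j. a < rel i j \<and> rel i j < b}"
  have fin: "finite ?S"
    using finite_released[OF i, of b] by (rule rev_finite_subset) auto
  define l h where "l = Min ?S" and "h = Max ?S"
  have l: "l \<in> ?S" and h: "h \<in> ?S"
    using Min_in[OF fin False] Max_in[OF fin False] by (simp_all only: l_def h_def)
  have "l \<le> h" using l fin by (auto simp: h_def)
  then have "rel i l + real (h - l) * period (ts i) \<le> rel i h"
    using release_spacing[OF i, of l "h - l"] by simp
  then have "real (h - l) * period (ts i) < real (Suc q) * period (ts i)"
    using l h b by auto
  then have "h - l < Suc q"
    using period_pos[OF i] by simp
  moreover have "?S \<subseteq> {l..h}"
    using fin by (auto simp: l_def h_def)
  then have "card ?S \<le> Suc h - l"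
    using card_mono[of "{l..h}" ?S] by simp
  ultimately show ?thesis by linarith
next
  case True
  then show ?thesis by (simp only: card.empty le0)
qed

section \<open>Demand ahead of an unfinished job\<close>

text \<open>The bound is strict because node \<open>v\<close> has not received its full execution
  time. Only jobs released after \<open>rel k j - period (ts i)\<close> count, as older ones met a
  deadline no later than \<open>rel k j\<close>.\<close>

lemma unfinished_job_demand:
  assumes k: "k \<in> {1..n}"
    and e: "rel k j < e" "e \<le> rel k j + period (ts k)"
    and higher: "\<And>i j'. i \<in> {1..<k} \<Longrightarrow> meets_deadline ts jobs \<sigma> i j'"
    and earlier: "\<And>j'. j' < j \<Longrightarrow> meets_deadline ts jobs \<sigma> k j'"
    and v: "v \<in> nodes (G k j)" "\<not> executed jobs \<sigma> e (k, j, v)"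
  shows "real M * (e - rel k j) < real M * span_bound (ts k) + work_bound (ts k) +
    (\<Sum>i=1..<k. real (card {j'. rel k j - period (ts i) < rel i j' \<and> rel i j' < e}) *
      work_bound (ts i))"
proof -
  define r where "r = rel k j"
  have r0: "0 \<le> r" using job_facts(1)[OF k] by (simp add: r_def)
  have sub: "i \<in> {1..n}" if "i \<in> {1..k}" for i using that k by auto
  define J where "J = (\<lambda>i. {j'. rel i j' < e})"
  have finJ: "finite (J i)" if "i \<in> {1..k}" for i
    using finite_released[OF sub[OF that]] by (simp add: J_def)
  have finG: "finite (nodes (G i j'))" if "i \<in> {1..k}" for i j'
    using job_facts(3)[OF sub[OF that]] by (simp add: dag_wf_def)
  define F where "F = (SIGMA i:{1..k}. SIGMA j':J i. nodes (G i j'))"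
  have finF: "finite F"
    unfolding F_def using finJ finG by (intro finite_SigmaI) auto
  \<comment> \<open>Counting within \<open>F\<close> ignores lower-priority subtasks: an instant
    where one of them holds a processor belongs to \<open>N\<close>.\<close>
  define B where "B = {r..<e} \<inter> {s. card {x \<in> F. s \<in> runs x} = M}"
  define N where "N = {r..<e} - B"
  have count: "real (card {x \<in> F. s \<in> runs x}) = (\<Sum>x\<in>F. indicator (runs x) s)" for s
    using finF by (simp add: indicator_def Int_def)
  \<comment> \<open>A finite sum of indicators makes the cardinality condition measurable.\<close>
  have "{s. card {x \<in> F. s \<in> runs x} = M} = {s. (\<Sum>x\<in>F. indicator (runs x) s) = real M}"
    using count by (metis (no_types, lifting) of_nat_eq_iff)
  moreover have "{s. (\<Sum>x\<in>F. indicator (runs x) s) = real M} \<in> sets borel"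
    by measurable
  ultimately have B: "B \<in> sets borel" unfolding B_def by auto
  then have N: "N \<in> sets borel" unfolding N_def by auto
  have fmB: "B \<in> fmeasurable lborel"
    by (rule fmeasurableI2[of "{r..e}"]) (use B in \<open>auto simp: B_def\<close>)
  have fmN: "N \<in> fmeasurable lborel"
    by (rule fmeasurableI2[of "{r..e}"]) (use N in \<open>auto simp: N_def\<close>)

  \<comment> \<open>If a ready node waits, \<open>M\<close> subtasks of index at most
    \<open>k\<close> run. All lie in \<open>F\<close>, so the instant belongs to
    \<open>B\<close>.\<close>
  have busy: "(k, j, w) \<in> \<sigma> s" if s: "s \<in> N" and rdy: "(k, j, w) \<in> ready_subtasks n jobs \<sigma> s" for s w
  proof (rule ccontr)
    assume notin: "(k, j, w) \<notin> \<sigma> s"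
    have s': "r \<le> s" "s < e" "0 \<le> s" using s r0 by (auto simp: N_def)
    have "\<forall>x\<in>ready_subtasks n jobs \<sigma> s - \<sigma> s. card (\<sigma> s) = M \<and> (\<forall>y\<in>\<sigma> s. fst y \<le> fst x)"
      using fp s'(3) unfolding global_fp_schedule_def by blast
    from bspec[OF this DiffI[OF rdy notin]]
    have \<sigma>: "card (\<sigma> s) = M" "\<And>y. y \<in> \<sigma> s \<Longrightarrow> fst y \<le> k"
      by auto
    have "\<sigma> s \<subseteq> F"
      using running_ready[OF s'(3)] \<sigma>(2) s' by (fastforce simp: F_def J_def ready_subtasks_def)
    then have "{x \<in> F. s \<in> runs x} = \<sigma> s" by auto
    then show False
      using s \<sigma>(1) by (auto simp: N_def B_def)
  qed
  obtain p where p: "p \<in> dag_paths (G k j)"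
    "measure lborel (N \<inter> {..<e}) \<le> sum_list (map (exec_time (G k j)) p)"
  proof -
    have "N \<subseteq> {r..}" by (auto simp: N_def)
    moreover have "\<not> executed jobs \<sigma> s (k, j, v)" if "s < e" for s
      using v(2) executed_mono[of s _ e] that by auto
    ultimately show ?thesis
      using path_covers[OF k _ N _ busy v(1), of r e] that by (auto simp: r_def)
  qed
  have "N \<inter> {..<e} = N" by (auto simp: N_def)
  then have N_le: "measure lborel N \<le> span_bound (ts k)"
    using p dag_path_le_critical_path_length[OF job_facts(3)[OF k] p(1)] job_facts(5)[OF k, of j]
    by simp

  \<comment> \<open>Processor time that one job receives during \<open>B\<close>.\<close>
  define W where "W = (\<lambda>i j'. \<Sum>w\<in>nodes (G i j'). measure lborel (B \<inter> runs (i, j', w)))"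
  have node: "measure lborel (B \<inter> runs x) \<le> service \<sigma> x e" for x
    using B r0 by (intro measure_le_service) (auto simp: B_def)
  have W_le: "W i j' \<le> work_bound (ts i)" if "i \<in> {1..k}" for i j'
  proof -
    have "W i j' \<le> total_work (G i j')"
      unfolding W_def total_work_def
      using sub[OF that] by (intro sum_mono order_trans[OF node] service_le_exec_time exec_time_nonneg)
    then show ?thesis using job_facts(4)[OF sub[OF that], of j'] by linarith
  qed
  have W_0: "W i j' = 0" if "meets_deadline ts jobs \<sigma> i j'" "rel i j' + period (ts i) \<le> r" for i j'
    unfolding W_def
  proof (intro sum.neutral ballI)
    fix w assume "w \<in> nodes (G i j')"
    then have "executed jobs \<sigma> r (i, j', w)"
      using that executed_mono by (auto simp: meets_deadline_def)
    then have "B \<inter> runs (i, j', w) = {}"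
      using executed_not_running r0 by (force simp: B_def)
    then show "measure lborel (B \<inter> runs (i, j', w)) = 0" by simp
  qed
  have W_kj: "W k j < work_bound (ts k)"
  proof -
    have "W k j < total_work (G k j)"
      unfolding W_def total_work_def
    proof (rule sum_strict_mono_ex1)
      show "finite (nodes (G k j))" using finG k by auto
      show "\<forall>w\<in>nodes (G k j). measure lborel (B \<inter> runs (k, j, w)) \<le> exec_time (G k j) w"
        using k by (intro ballI order_trans[OF node] service_le_exec_time exec_time_nonneg)
      show "\<exists>w\<in>nodes (G k j). measure lborel (B \<inter> runs (k, j, w)) < exec_time (G k j) w"
        using v node[of "(k, j, v)"] by (intro bexI[of _ v]) (auto simp: executed_def)
    qed
    then show ?thesis using job_facts(4)[OF k, of j] by linarith
  qed
  \<comment> \<open>Earlier jobs of task \<open>k\<close> were finished by \<open>r\<close>, and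
    later ones are released no earlier than \<open>e\<close>.\<close>
  have Jk: "(\<Sum>j'\<in>J k. W k j') = W k j"
  proof -
    have "W k j' = 0" if "j' \<in> J k" "j' \<noteq> j" for j'
    proof -
      have gap: "rel k a + period (ts k) \<le> rel k b" if "a < b" for a b
      proof -
        obtain m where m: "b = a + Suc m"
          using \<open>a < b\<close> less_iff_Suc_add by auto
        have "0 \<le> real m * period (ts k)"
          using period_pos[OF k] by simp
        then show ?thesis
          using release_spacing[OF k, of a "Suc m"] m by (simp add: algebra_simps)
      qed
      have "\<not> j < j'"
        using gap[of j j'] that e(2) by (auto simp: J_def)
      then have "j' < j" using that by simp
      then show ?thesis
        using gap[of j' j] earlier by (intro W_0) (auto simp: r_def)
    qed
    moreover have "j \<in> J k" using e by (simp add: J_def)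
    ultimately show ?thesis
      using finJ[of k] k by (subst sum.remove[of _ j]) (auto intro!: sum.neutral)
  qed
  have Ji: "(\<Sum>j'\<in>J i. W i j')
      \<le> real (card {j'. r - period (ts i) < rel i j' \<and> rel i j' < e}) * work_bound (ts i)"
    if i: "i \<in> {1..<k}" for i
  proof -
    let ?A = "{j'. r - period (ts i) < rel i j' \<and> rel i j' < e}"
    have i': "i \<in> {1..k}" using i by auto
    have "(\<Sum>j'\<in>J i. W i j') = (\<Sum>j'\<in>?A. W i j')"
      using finJ[OF i'] higher[OF i] by (intro sum.mono_neutral_right) (auto simp: J_def intro!: W_0)
    also have "\<dots> \<le> (\<Sum>j'\<in>?A. work_bound (ts i))"
      using W_le[OF i'] by (intro sum_mono)
    finally show ?thesis by simp
  qed
  have "real M * measure lborel B = (\<Sum>i=1..k. \<Sum>j'\<in>J i. W i j')"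
  proof -
    have "real M * measure lborel B = (\<Sum>x\<in>F. measure lborel (B \<inter> runs x))"
      using finF fmB by (intro measure_count_sum) (auto simp: B_def)
    also have "\<dots> = (\<Sum>i=1..k. \<Sum>j'\<in>J i. W i j')"
      unfolding F_def W_def using finJ finG
      by (simp add: sum.Sigma case_prod_unfold)
    finally show ?thesis .
  qed
  also have "\<dots> = W k j + (\<Sum>i=1..<k. \<Sum>j'\<in>J i. W i j')"
  proof -
    have *: "{1..k} = insert k {1..<k}" using k by auto
    show ?thesis by (subst *, subst sum.insert) (auto simp: Jk)
  qed
  also have "\<dots> < work_bound (ts k) +
    (\<Sum>i=1..<k. real (card {j'. r - period (ts i) < rel i j' \<and> rel i j' < e}) * work_bound (ts i))"
    using W_kj Ji by (intro add_less_le_mono sum_mono)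
  finally have B_less: "real M * measure lborel B < work_bound (ts k) +
    (\<Sum>i=1..<k. real (card {j'. r - period (ts i) < rel i j' \<and> rel i j' < e}) * work_bound (ts i))" .
  have "B \<union> N = {r..<e}" "B \<inter> N = {}" by (auto simp: N_def B_def)
  then have "e - r = measure lborel B + measure lborel N"
    using measure_Un3[OF fmB fmN] e by (simp add: r_def)
  then have "real M * (e - r) = real M * measure lborel B + real M * measure lborel N"
    by (simp add: algebra_simps)
  moreover have "real M * measure lborel N \<le> real M * span_bound (ts k)"
    using mult_left_mono[OF N_le] by simp
  ultimately show ?thesis
    using B_less unfolding r_def by linarith
qed

text \<open>Strong induction on the job number supplies the deadlines of earlier jobs of the same
  task. A miss makes the demand exceed the supply at every candidate point, against
  \<open>k_point_test\<close>.\<close>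

lemma meets_deadline_of_k_point_test:
  assumes "1 \<le> M" and k: "k \<in> {1..n}" and "rate_monotonic n ts"
    and higher: "\<And>i j'. i \<in> {1..<k} \<Longrightarrow> meets_deadline ts jobs \<sigma> i j'"
    and cond: "(span_bound (ts k) / period (ts k) + 2) *
            (\<Prod>j=1..k. (utilization (ts j) / real M + 1)) \<le> 3"
  shows "meets_deadline ts jobs \<sigma> k j"
proof (induction j rule: less_induct)
  case (less j)
  show ?case
  proof (rule ccontr)
    define T where "T = period (ts k)"
    \<comment> \<open>The number of whole periods of task \<open>i\<close> that fit into
      \<open>T\<close>; rate-monotonic order makes it at least 1.\<close>
    define q where "q = (\<lambda>i. nat \<lfloor>T / period (ts i)\<rfloor>)"
    define t where "t = (\<lambda>i. real (q i) * period (ts i))"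
    define u where "u = (\<lambda>i. utilization (ts i) / real M)"
    \<comment> \<open>The share of the job itself in the demand, divided by
      \<open>M\<close>.\<close>
    define A where "A = span_bound (ts k) + work_bound (ts k) / real M"
    assume "\<not> ?case"
    then obtain v where v: "v \<in> nodes (G k j)" "\<not> executed jobs \<sigma> (rel k j + T) (k, j, v)"
      by (auto simp: meets_deadline_def T_def)
    have T: "0 < T" using period_pos[OF k] by (simp add: T_def)
    have M: "0 < real M" using assms(1) by simp
    have span: "0 \<le> span_bound (ts k)"
      using critical_path_length_nonneg[OF job_facts(3)[OF k]] job_facts(5)[OF k]
      by (rule order_trans)
    have u: "0 \<le> u i" if "i \<in> {1..n}" for i
      using period_pos[OF that] work_bound_pos[OF that] by (simp add: u_def utilization_def)
    have A: "0 < A"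
      using span M work_bound_pos[OF k] by (simp add: A_def add_nonneg_pos)
    have sub: "i \<in> {1..n}" "period (ts i) \<le> T" if "i \<in> {1..<k}" for i
      using that k assms(3) by (auto simp: rate_monotonic_def T_def)
    have t: "1 \<le> q i" "t i \<le> T" "T < t i + period (ts i)" if "i \<in> {1..<k}" for i
    proof -
      have p: "0 < period (ts i)" using period_pos sub(1)[OF that] by blast
      have "1 \<le> T / period (ts i)" using sub(2)[OF that] p by simp
      then have fl: "1 \<le> \<lfloor>T / period (ts i)\<rfloor>" by linarith
      then show "1 \<le> q i" by (simp add: q_def le_nat_iff)
      have "real (q i) \<le> T / period (ts i)" "T / period (ts i) < real (q i) + 1"
        using fl by (simp_all add: q_def)
      then show "t i \<le> T" "T < t i + period (ts i)"
        using p by (simp_all add: t_def field_simps)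
    qed
    have t_pos: "0 < t i" if "i \<in> {1..<k}" for i
      using t(1)[OF that] period_pos[OF sub(1)[OF that]] by (simp add: t_def)
    let ?P = "\<Prod>i=1..<k. u i + 1"
    txt \<open>The factor \<open>U\<^sub>k / M + 1\<close> of the hypothesis pays for the work \<open>C\<^sub>k\<close> of the job itself.\<close>
    have "(A / T + 2) * ?P \<le> (span_bound (ts k) / T + 2) * (u k + 1) * ?P"
    proof (rule mult_right_mono)
      have "(span_bound (ts k) / T + 2) * (u k + 1) - (A / T + 2)
          = span_bound (ts k) / T * u k + u k"
        using T M by (simp add: A_def u_def utilization_def T_def field_simps)
      moreover have "0 \<le> span_bound (ts k) / T * u k + u k"
        using span T u[OF k] by simp
      ultimately show "A / T + 2 \<le> (span_bound (ts k) / T + 2) * (u k + 1)" by linarith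
      show "0 \<le> ?P" using u sub by (intro prod_nonneg) simp
    qed
    also have "\<dots> = (span_bound (ts k) / T + 2) * (\<Prod>i=1..k. u i + 1)"
    proof -
      have *: "{1..k} = insert k {1..<k}" using k by auto
      show ?thesis by (subst *, subst prod.insert) (auto simp: mult.assoc)
    qed
    also have "\<dots> \<le> 3" using cond by (simp add: u_def T_def)
    finally have "(A / T + 2) * ?P \<le> 3" .
    then have "\<exists>\<tau>\<in>insert T (t ` {1..<k}).
        A + (\<Sum>l=1..<k. u l * t l * (2 + of_bool (t l < \<tau>))) \<le> \<tau>"
      using A T by (intro k_point_test u sub(1) less_imp_le[OF t_pos]) auto
    then obtain \<tau> where \<tau>: "\<tau> \<in> insert T (t ` {1..<k})"
      "A + (\<Sum>l=1..<k. u l * t l * (2 + of_bool (t l < \<tau>))) \<le> \<tau>"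
      by blast
    have \<tau>T: "0 < \<tau>" "\<tau> \<le> T" using \<tau>(1) T t t_pos by auto
    have "\<not> executed jobs \<sigma> (rel k j + \<tau>) (k, j, v)"
      using v(2) \<tau>T executed_mono[of "rel k j + \<tau>" _ "rel k j + T"] by auto
    then have "real M * \<tau> < real M * span_bound (ts k) + work_bound (ts k) +
      (\<Sum>i=1..<k. real (card {j'. rel k j - period (ts i) < rel i j' \<and> rel i j' < rel k j + \<tau>}) *
        work_bound (ts i))"
      using unfinished_job_demand[OF k _ _ higher less v(1), of "rel k j + \<tau>"] \<tau>T
      by (simp add: T_def)
    also have "\<dots> \<le> real M * A + (\<Sum>i=1..<k. real M * (u i * t i * (2 + of_bool (t i < \<tau>))))"
    proof (intro add_mono sum_mono)
      show "real M * span_bound (ts k) + work_bound (ts k) \<le> real M * A"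
        using M by (simp add: A_def algebra_simps)
      fix i assume i: "i \<in> {1..<k}"
      let ?c = "card {j'. rel k j - period (ts i) < rel i j' \<and> rel i j' < rel k j + \<tau>}"
      \<comment> \<open>The release window has length \<tau> plus one period: at most
        \<open>q i + 1\<close> periods if \<tau> does not exceed \<open>t i\<close>, and at most
        \<open>q i + 2\<close> otherwise. As \<open>1 \<le> q i\<close>, these are at most
        \<open>2 * q i\<close> and \<open>3 * q i\<close>.\<close>
      have c: "?c \<le> q i * (2 + of_bool (t i < \<tau>))"
      proof (cases "t i < \<tau>")
        case True
        have "?c \<le> Suc (Suc (q i))"
          using t[OF i] \<tau>T by (intro card_released_le sub[OF i]) (auto simp: t_def algebra_simps)
        then show ?thesis using True t(1)[OF i] by simp
      next
        case False
        then have "?c \<le> Suc (q i)"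
          by (intro card_released_le sub[OF i]) (auto simp: t_def algebra_simps)
        then show ?thesis using False t(1)[OF i] by simp
      qed
      have "real ?c * work_bound (ts i) \<le> real (q i * (2 + of_bool (t i < \<tau>))) * work_bound (ts i)"
        using c work_bound_pos[OF sub(1)[OF i]] by (intro mult_right_mono) (auto simp only: of_nat_le_iff)
      also have "\<dots> = real M * (u i * t i * (2 + of_bool (t i < \<tau>)))"
        using M period_pos[OF sub(1)[OF i]] by (simp add: u_def t_def utilization_def)
      finally show "real ?c * work_bound (ts i) \<le> real M * (u i * t i * (2 + of_bool (t i < \<tau>)))" .
    qed
    also have "\<dots> = real M * (A + (\<Sum>i=1..<k. u i * t i * (2 + of_bool (t i < \<tau>))))"
      by (simp only: sum_distrib_left distrib_left)
    also have "\<dots> \<le> real M * \<tau>"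
      using \<tau>(2) M by (intro mult_left_mono) auto
    finally show False by simp
  qed
qed

end

theorem theorem4:
  fixes M n k :: nat and ts :: "nat \<Rightarrow> dag_task"
  assumes "1 \<le> M" and "2 \<le> k" and "k \<le> n"
    and "dag_task_system n ts"
    and "rate_monotonic n ts"
    and "\<forall>i\<in>{1..<k}. schedulable M n ts i"
    and "(span_bound (ts k) / period (ts k) + 2) *
            (\<Prod>j=1..k. (utilization (ts j) / real M + 1)) \<le> 3 \<or>
         (\<Sum>j=1..k. utilization (ts j) / real M)
            \<le> ln (3 / (span_bound (ts k) / period (ts k) + 2))"
  shows "schedulable M n ts k"
  unfolding schedulable_def
proof (intro allI impI)
  fix jobs \<sigma> j
  assume jobs: "sporadic_jobs n ts jobs" and \<sigma>: "global_fp_schedule M n jobs \<sigma>"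
  interpret fp_execution M n ts jobs \<sigma>
    using assms(4) jobs \<sigma> by unfold_locales
  have k: "k \<in> {1..n}" using assms(2,3) by auto
  \<comment> \<open>The given jobs witness this: their critical path lengths are non-negative. It
    makes the denominator under \<open>ln\<close> positive.\<close>
  have "0 \<le> span_bound (ts k)"
    using critical_path_length_nonneg[OF job_facts(3)[OF k]] job_facts(5)[OF k]
    by (rule order_trans)
  then have pos: "0 < span_bound (ts k) / period (ts k) + 2"
    using period_pos[OF k] by (simp add: add_nonneg_pos)
  have u: "0 \<le> utilization (ts i) / real M" if "i \<in> {1..k}" for i
    using that period_pos[of i] work_bound_pos[of i] assms(3) by (simp add: utilization_def)
  have "(span_bound (ts k) / period (ts k) + 2) *
      (\<Prod>j=1..k. (utilization (ts j) / real M + 1)) \<le> 3"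
    using assms(7)
  proof
    assume "(\<Sum>j=1..k. utilization (ts j) / real M) \<le> ln (3 / (span_bound (ts k) / period (ts k) + 2))"
    then have "(\<Prod>j=1..k. (utilization (ts j) / real M + 1)) \<le> 3 / (span_bound (ts k) / period (ts k) + 2)"
      using u pos by (intro prod_le_of_sum_le_ln) auto
    then show ?thesis using pos by (simp add: pos_le_divide_eq mult.commute)
  qed
  moreover have "meets_deadline ts jobs \<sigma> i j'" if "i \<in> {1..<k}" for i j'
    using assms(6) that jobs \<sigma> by (auto simp: schedulable_def)
  ultimately show "meets_deadline ts jobs \<sigma> k j"
    using meets_deadline_of_k_point_test[OF assms(1) k assms(5)] by blast
qed

end
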